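(* For $i\in\{1,2\}$, let $f_i:\mathrm{dom}(f_i)\to\mathbb{R}$ be a concave function with closed convex domain $\mathrm{dom}(f_i)\subseteq\mathbb{R}^{p_i}$. Let $\mathcal{S}:=\{(u,v)\in\mathrm{dom}(f_1)\times\mathrm{dom}(f_2): f_1(u)-f_2(v)\le 0\}$. Suppose that: (i) at least one of $f_1,f_2$ is positive homogeneous of degree 1; (ii) $f_1,f_2$ are both positive over the interiors of their domains, or both negative over the interiors of their domains; (iii) $f_1$ is continuously differentiable over $\mathrm{int}(\mathrm{dom}(f_1))$; and (iv) $\mathrm{dom}(f_1)$ and $\mathrm{dom}(f_2)$ are full-dimensional in $\mathbb{R}^{p_1}$ and $\mathbb{R}^{p_2}$, respectively. Then, for any $\tilde v\in\mathrm{int}(\mathrm{dom}(f_2))$ at which $f_2$ is differentiable, the set $$\mathcal{C}:=\{(u,v)\in\mathrm{dom}(f_1)\times\mathrm{dom}(f_2): f_1(u)-\Xi^{f_2}_{\tilde v}(v)\ge 0\}$$ is a maximal $\mathcal{S}$-free set in $\mathrm{dom}(f_1)\times\mathrm{dom}(f_2)$.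
   Context: For a function $f$ differentiable at $\tilde x$, $\Xi^{f}_{\tilde x}(x):=f(\tilde x)+\nabla f(\tilde x)\cdot(x-\tilde x)$ denotes its linearization at $\tilde x$. A function $f$ is positive homogeneous of degree $d\in\mathbb{R}$ if for any $z\in\mathrm{dom}(f)$ and any $\rho>0$, $f(\rho z)=\rho^d f(z)$ (in particular $\rho z\in\mathrm{dom}(f)$). Given $\mathcal{S}\subsetneq\mathbb{R}^p$, a closed set $\mathcal{C}\subseteq\mathbb{R}^p$ is $\mathcal{S}$-free if $\mathcal{C}$ is convex and $\mathrm{int}(\mathcal{C})\cap\mathcal{S}=\varnothing$. Given a closed convex set $\mathcal{G}\subseteq\mathbb{R}^p$ with $\mathcal{S}\subsetneq\mathcal{G}$, an $\mathcal{S}$-free set $\mathcal{C}$ is maximal in $\mathcal{G}$ if there is no other $\mathcal{S}$-free set $\mathcal{C}'$ such that $\mathcal{C}\cap\mathcal{G}\subsetneq\mathcal{C}'\cap\mathcal{G}$.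
   Formalization: The formal theorem additionally assumes that f_1 is upper semicontinuous on its closed domain (closed hypograph); without this C can fail to be closed, e.g. f_1(0)=0, f_1=1 on (0,1], f_2(v)=v on [0,∞), ṽ=1. *)

theory Defs
  imports "HOL-Analysis.Analysis"
begin

text \<open>
  A real function with a restricted domain is represented by a total function together with
  its domain; its values outside the domain are irrelevant.
\<close>

definition pos_homogeneous_on :: "'a::real_vector set \<Rightarrow> ('a \<Rightarrow> real) \<Rightarrow> real \<Rightarrow> bool" where
  "pos_homogeneous_on D f d \<longleftrightarrow>
     (\<forall>z\<in>D. \<forall>\<rho>>0. \<rho> *\<^sub>R z \<in> D \<and> f (\<rho> *\<^sub>R z) = \<rho> powr d * f z)"

text \<open>
  The gradient is only meaningful at points where the function is differentiable.
\<close>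

definition gradient :: "('a::real_inner \<Rightarrow> real) \<Rightarrow> 'a \<Rightarrow> 'a" where
  "gradient f x = (THE g. GDERIV f x :> g)"

definition linearization :: "('a::real_inner \<Rightarrow> real) \<Rightarrow> 'a \<Rightarrow> 'a \<Rightarrow> real" where
  "linearization f x0 x = f x0 + gradient f x0 \<bullet> (x - x0)"

definition continuously_differentiable_on_open ::
    "'a::euclidean_space set \<Rightarrow> ('a \<Rightarrow> real) \<Rightarrow> bool" where
  "continuously_differentiable_on_open U f \<longleftrightarrow>
     open U \<and> (\<forall>x\<in>U. f differentiable (at x)) \<and> continuous_on U (gradient f)"

text \<open>
  The requirement that the hypograph be closed, phrased through the epigraph of the negated
  function, is the usual notion of a closed concave function. On a closed domain it says that
  the function is upper semicontinuous there.
\<close>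

definition closed_hypograph_on :: "'a::euclidean_space set \<Rightarrow> ('a \<Rightarrow> real) \<Rightarrow> bool" where
  "closed_hypograph_on D f \<longleftrightarrow> closed (epigraph D (\<lambda>x. - f x))"

definition S_free :: "'a::euclidean_space set \<Rightarrow> 'a set \<Rightarrow> bool" where
  "S_free S C \<longleftrightarrow> S \<subset> UNIV \<and> closed C \<and> convex C \<and> interior C \<inter> S = {}"

text \<open>
  The standing requirements on the ambient set \<open>G\<close> are part of the definition, so a
  maximality claim includes that \<open>S\<close> is a proper subset of \<open>G\<close>.
\<close>

definition maximal_S_free_in ::
    "'a::euclidean_space set \<Rightarrow> 'a set \<Rightarrow> 'a set \<Rightarrow> bool" where
  "maximal_S_free_in S G C \<longleftrightarrow>
     closed G \<and> convex G \<and> S \<subset> G \<and> S_free S C \<and>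
     \<not> (\<exists>C'. S_free S C' \<and> C \<inter> G \<subset> C' \<inter> G)"

end

theory Submission
  imports Defs
begin

text \<open>
  Write \<open>h (u, v) = f1 u - \<Xi> v\<close>, with \<open>\<Xi>\<close> the linearization of \<open>f2\<close> at the given point, so that
  \<open>C\<close> is the set where \<open>h \<ge> 0\<close>. By concavity \<open>f2 \<le> \<Xi>\<close>, hence \<open>h = 0\<close> at every common point of \<open>C\<close>
  and \<open>S\<close>. Scaling the homogeneous argument makes \<open>h\<close> change sign there, because \<open>f1\<close> does
  not vanish on the interior; so no such point is interior to \<open>C\<close>.

  For maximality, let \<open>w = (u, v)\<close> be a point outside \<open>C\<close> of an \<open>S\<close>-free set \<open>C'\<close> containing \<open>C\<close>.
  Since \<open>C\<close> is closed, \<open>w\<close> may be moved towards \<open>C\<close> so that \<open>u\<close> is interior. Scaling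
  either \<open>u\<close> or the base point of \<open>\<Xi>\<close> yields a point \<open>p\<close> with \<open>f1 = f2 = \<Xi>\<close>, and \<open>h\<close> is affine on the
  line from \<open>w\<close> through \<open>p\<close>. Hence \<open>h\<close> is positive slightly beyond \<open>p\<close>, which places \<open>p\<close>
  strictly between an interior point of \<open>C\<close> and \<open>w\<close>, so \<open>p\<close> is a point of \<open>S\<close> interior to \<open>C'\<close>.
\<close>

section \<open>Gradients, concavity and positive homogeneity\<close>

lemma has_real_derivative_gradient:
  fixes f :: "'a::euclidean_space \<Rightarrow> real"
  assumes "f differentiable (at x)"
  shows "((\<lambda>t. f (x + t *\<^sub>R d)) has_real_derivative gradient f x \<bullet> d) (at 0)"
proof -
  obtain F where F: "(f has_derivative F) (at x)"
    using assms by (auto simp: differentiable_def)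
  interpret F: linear F
    using F has_derivative_linear by blast
  \<comment> \<open>The adjoint evaluated at \<open>1\<close> is the Riesz representative of the
    functional \<open>F\<close>. Uniqueness of the derivative then identifies it with the
    description in \<open>gradient\<close>.\<close>
  define g where "g = adjoint F 1"
  have "F = (\<lambda>h. h \<bullet> g)"
    using adjoint_works[OF F.linear_axioms, of _ 1] by (auto simp: g_def fun_eq_iff)
  then have g: "GDERIV f x :> g"
    using F by (simp add: gderiv_def)
  have "gradient f x = g"
    unfolding gradient_def
  proof (rule the_equality)
    show "GDERIV f x :> g"
      by (rule g)
  next
    fix g' assume "GDERIV f x :> g'"
    then have "(\<lambda>h. h \<bullet> g') = (\<lambda>h. h \<bullet> g)"
      using g has_derivative_unique unfolding gderiv_def by blast
    then show "g' = g"
      by (metis inner_commute vector_eq_ldot)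
  qed
  then have "(f has_derivative (\<lambda>h. h \<bullet> gradient f x)) (at (x + 0 *\<^sub>R d))"
    using g by (simp add: gderiv_def)
  moreover have "((\<lambda>t. x + t *\<^sub>R d) has_derivative (\<lambda>t. t *\<^sub>R d)) (at 0)"
    by (auto intro!: derivative_eq_intros)
  ultimately have "((\<lambda>t. f (x + t *\<^sub>R d)) has_derivative (\<lambda>t. (t *\<^sub>R d) \<bullet> gradient f x)) (at 0)"
    by (rule has_derivative_compose[rotated])
  then show ?thesis
    by (simp add: has_field_derivative_def inner_commute mult.commute[of _ "inner _ _"])
qed

text \<open>By concavity the difference quotients from \<open>x\<close> towards \<open>y\<close> are
  at least \<open>f y - f x\<close>, and this bound passes to their limit, the directional
  derivative at \<open>x\<close>.\<close>

lemma concave_on_le_linearization: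
  fixes f :: "'a::euclidean_space \<Rightarrow> real"
  assumes f: "concave_on D f" and xy: "x \<in> D" "y \<in> D" and "f differentiable (at x)"
  shows "f y \<le> linearization f x y"
proof -
  define \<phi> where "\<phi> t = f (x + t *\<^sub>R (y - x))" for t
  have "(\<phi> has_real_derivative gradient f x \<bullet> (y - x)) (at 0)"
    unfolding \<phi>_def by (rule has_real_derivative_gradient[OF assms(4)])
  then have "((\<lambda>t. (\<phi> t - \<phi> 0) / t) \<longlongrightarrow> gradient f x \<bullet> (y - x)) (at_right 0)"
    by (auto dest!: DERIV_D simp: filterlim_at_split)
  moreover have "\<forall>\<^sub>F t in at_right 0. f y - f x \<le> (\<phi> t - \<phi> 0) / t"
    unfolding eventually_at_right_field
  proof (intro exI[of _ 1] conjI allI impI)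
    fix t :: real assume t: "0 < t" "t < 1"
    have "(1 - t) * f x + t * f y \<le> f ((1 - t) *\<^sub>R x + t *\<^sub>R y)"
      using concave_onD[OF f, of t x y] t xy by simp
    also have "(1 - t) *\<^sub>R x + t *\<^sub>R y = x + t *\<^sub>R (y - x)"
      by (simp add: algebra_simps)
    finally show "f y - f x \<le> (\<phi> t - \<phi> 0) / t"
      using t by (simp add: \<phi>_def field_simps)
  qed simp
  ultimately have "f y - f x \<le> gradient f x \<bullet> (y - x)"
    by (rule tendsto_lowerbound) simp
  then show ?thesis
    by (simp add: linearization_def)
qed

lemma pos_homogeneous_on_one:
  assumes "pos_homogeneous_on D f 1" "z \<in> D" "\<rho> > 0"
  shows "\<rho> *\<^sub>R z \<in> D" "f (\<rho> *\<^sub>R z) = \<rho> * f z"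
  using assms by (auto simp: pos_homogeneous_on_def)

lemma pos_homogeneous_on_interior:
  fixes D :: "'a::euclidean_space set"
  assumes f: "pos_homogeneous_on D f d" and z: "z \<in> interior D" and \<rho>: "\<rho> > 0"
  shows "\<rho> *\<^sub>R z \<in> interior D"
proof -
  have "open ((*\<^sub>R) \<rho> ` interior D)"
    using \<rho> by (intro open_scaling) auto
  moreover have "(*\<^sub>R) \<rho> ` interior D \<subseteq> D"
    using f \<rho> interior_subset[of D] by (auto simp: pos_homogeneous_on_def)
  ultimately show ?thesis
    using z interior_maximal by blast
qed

text \<open>Euler's identity \<open>gradient f x \<bullet> x = f x\<close> cancels the constant
  term. It follows by differentiating \<open>f\<close> along the ray through \<open>x\<close> in two
  ways.\<close>

lemma linearization_pos_homogeneous: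
  fixes f :: "'a::euclidean_space \<Rightarrow> real"
  assumes f: "pos_homogeneous_on D f 1" and x: "x \<in> D" "f differentiable (at x)"
  shows "linearization f x y = gradient f x \<bullet> y"
proof -
  have "((\<lambda>t. f (x + t *\<^sub>R x)) has_real_derivative gradient f x \<bullet> x) (at 0)"
    by (rule has_real_derivative_gradient[OF x(2)])
  moreover have "((\<lambda>t. f (x + t *\<^sub>R x)) has_real_derivative f x) (at 0)"
  proof (rule DERIV_cong_ev[THEN iffD2])
    \<comment> \<open>For \<open>t > -1\<close> the scaling factor \<open>1 + t\<close> is positive,
      so homogeneity applies on both sides of \<open>0\<close>.\<close>
    have "\<forall>\<^sub>F t in nhds 0. t > (-1 :: real)"
      using eventually_nhds_in_open[of "{-1<..}" "0::real"] by simp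
    then show "\<forall>\<^sub>F t in nhds 0. f (x + t *\<^sub>R x) = (1 + t) * f x"
    proof eventually_elim
      case (elim t)
      then show ?case
        using pos_homogeneous_on_one(2)[OF f x(1), of "1 + t"] by (simp add: algebra_simps)
    qed
    show "((\<lambda>t. (1 + t) * f x) has_real_derivative f x) (at 0)"
      by (auto intro!: derivative_eq_intros)
  qed auto
  ultimately have "gradient f x \<bullet> x = f x"
    by (rule DERIV_unique)
  then show ?thesis
    by (simp add: linearization_def inner_diff_right)
qed

lemma linearization_affine:
  "linearization f a (x + t *\<^sub>R (x - y))
    = linearization f a x + t * (linearization f a x - linearization f a y)"
  by (simp add: linearization_def inner_diff_right inner_add_right algebra_simps)

section \<open>Closedness and convexity of the superlevel set\<close>

lemma continuous_on_linearization [continuous_intros]: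
  fixes f :: "'a::real_inner \<Rightarrow> real"
  assumes "continuous_on A g"
  shows "continuous_on A (\<lambda>x. linearization f a (g x))"
  unfolding linearization_def using assms by (intro continuous_intros)

text \<open>The inequality says that \<open>(u, - linearization f2 a v)\<close> lies in the closed
  epigraph of \<open>- f1\<close>, so the set is a preimage under a continuous map, cut down to
  \<open>v \<in> D2\<close>. Only upper semicontinuity of \<open>f1\<close> enters, which covers
  boundary points of \<open>D1\<close>.\<close>

lemma superlevel_linearization_closed:
  fixes f1 :: "'a::euclidean_space \<Rightarrow> real" and f2 :: "'b::euclidean_space \<Rightarrow> real"
  assumes "closed_hypograph_on D1 f1" "closed D2"
  shows "closed {(u, v). u \<in> D1 \<and> v \<in> D2 \<and> f1 u - linearization f2 a v \<ge> 0}"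
proof -
  let ?k = "\<lambda>p. (fst p, - linearization f2 a (snd p))"
  have "closed (?k -` epigraph D1 (\<lambda>x. - f1 x))"
    using assms(1) unfolding closed_hypograph_on_def
    by (intro closed_vimage continuous_intros)
  moreover have "{(u, v). u \<in> D1 \<and> v \<in> D2 \<and> f1 u - linearization f2 a v \<ge> 0}
      = ?k -` epigraph D1 (\<lambda>x. - f1 x) \<inter> UNIV \<times> D2"
    by (auto simp: epigraph_def)
  ultimately show ?thesis
    using assms(2) by (auto intro!: closed_Int closed_Times)
qed

lemma superlevel_linearization_convex:
  fixes f1 :: "'a::euclidean_space \<Rightarrow> real" and f2 :: "'b::euclidean_space \<Rightarrow> real"
  assumes f1: "concave_on D1 f1" and D2: "convex D2"
  shows "convex {(u, v). u \<in> D1 \<and> v \<in> D2 \<and> f1 u - linearization f2 a v \<ge> 0}"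
proof (rule convexI, clarsimp)
  fix u v u' v' and s t :: real
  assume *: "u \<in> D1" "v \<in> D2" "linearization f2 a v \<le> f1 u"
    "u' \<in> D1" "v' \<in> D2" "linearization f2 a v' \<le> f1 u'"
    and st: "0 \<le> s" "0 \<le> t" "s + t = 1"
  have s: "s = 1 - t"
    using st by simp
  have "convex D1"
    using f1 by (simp add: concave_on_def convex_on_def)
  moreover have "linearization f2 a (s *\<^sub>R v + t *\<^sub>R v') \<le> f1 (s *\<^sub>R u + t *\<^sub>R u')"
  proof -
    have "linearization f2 a (s *\<^sub>R v + t *\<^sub>R v')
        = s * linearization f2 a v + t * linearization f2 a v'"
      unfolding s by (simp add: linearization_def inner_diff_right inner_add_right algebra_simps)
    also have "\<dots> \<le> s * f1 u + t * f1 u'"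
      using * st by (intro add_mono mult_left_mono) auto
    also have "\<dots> \<le> f1 (s *\<^sub>R u + t *\<^sub>R u')"
      using concave_onD[OF f1, of t u u'] * st unfolding s by simp
    finally show ?thesis .
  qed
  ultimately show "s *\<^sub>R u + t *\<^sub>R u' \<in> D1 \<and> s *\<^sub>R v + t *\<^sub>R v' \<in> D2 \<and>
      linearization f2 a (s *\<^sub>R v + t *\<^sub>R v') \<le> f1 (s *\<^sub>R u + t *\<^sub>R u')"
    using * st D2 by (auto simp: convexD)
qed

section \<open>Interior points, contact points and scaling\<close>

lemma interior_nonempty_full_aff_dim:
  fixes D :: "'a::euclidean_space set"
  assumes "convex D" "aff_dim D = int DIM('a)"
  shows "interior D \<noteq> {}"
proof -
  have "affine hull D = UNIV"
    using assms(2) aff_dim_eq_full by blast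
  moreover have "D \<noteq> {}"
    using assms(2) by auto
  ultimately show ?thesis
    using assms(1) rel_interior_eq_empty rel_interior_interior by metis
qed

lemma eventually_ray_in_interior:
  fixes x d :: "'a::real_normed_vector"
  assumes "x \<in> interior A"
  shows "\<forall>\<^sub>F t in at (0::real). x + t *\<^sub>R d \<in> interior A"
proof -
  have "((\<lambda>t::real. x + t *\<^sub>R d) \<longlongrightarrow> x + 0 *\<^sub>R d) (at 0)"
    by (intro tendsto_intros)
  then show ?thesis
    using assms by (intro topological_tendstoD) auto
qed

text \<open>If \<open>f1\<close> is homogeneous, \<open>q = a\<close> is kept and \<open>u\<close>
  is scaled until \<open>f1\<close> reaches \<open>f2 a\<close>; if \<open>f2\<close> is,
  \<open>p = u\<close> is kept and \<open>a\<close> is scaled until \<open>f2\<close> reaches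
  \<open>f1 u\<close>. The common sign makes the factor positive. In the first case the ray beyond
  \<open>p\<close> stays on the half-line through \<open>u\<close>, where \<open>f1\<close> is
  linear; in the second its first component is constant.\<close>

lemma contact_point:
  fixes f1 :: "'a::euclidean_space \<Rightarrow> real" and f2 :: "'b::euclidean_space \<Rightarrow> real"
  assumes homogeneous: "pos_homogeneous_on D1 f1 1 \<or> pos_homogeneous_on D2 f2 1"
    and a: "a \<in> interior D2" "f2 differentiable (at a)"
    and u: "u \<in> interior D1"
    and sign: "f1 u * f2 a > 0"
  obtains p q where "p \<in> interior D1" "q \<in> interior D2" "f1 p = f2 q" "f2 q = linearization f2 a q"
    and "\<forall>\<^sub>F t in at_right 0. f1 (p + t *\<^sub>R (p - u)) - linearization f2 a (q + t *\<^sub>R (q - v))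
            = t * (linearization f2 a v - f1 u)"
  using homogeneous
proof
  assume hom: "pos_homogeneous_on D1 f1 1"
  define r where "r = f2 a / f1 u"
  have r: "r > 0" "r * f1 u = f2 a"
    using sign by (auto simp: r_def zero_less_mult_iff zero_less_divide_iff)
  have uD: "u \<in> D1"
    using u interior_subset by blast
  have lin: "linearization f2 a a = f2 a"
    by (simp add: linearization_def)
  show thesis
  proof (rule that[of "r *\<^sub>R u" a])
    show "r *\<^sub>R u \<in> interior D1"
      using pos_homogeneous_on_interior[OF hom u r(1)] .
    show "f1 (r *\<^sub>R u) = f2 a"
      using pos_homogeneous_on_one(2)[OF hom uD r(1)] r(2) by simp
    have "\<forall>\<^sub>F t in at_right 0. t < r \<and> 0 < t"
      using r(1) unfolding eventually_at_right_field by blast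
    then show "\<forall>\<^sub>F t in at_right 0. f1 (r *\<^sub>R u + t *\<^sub>R (r *\<^sub>R u - u))
        - linearization f2 a (a + t *\<^sub>R (a - v)) = t * (linearization f2 a v - f1 u)"
    proof eventually_elim
      case (elim t)
      \<comment> \<open>The factor multiplying \<open>u\<close> is \<open>(r - t) + t * r\<close>,
        positive because \<open>t < r\<close>.\<close>
      have "0 < t * r"
        using elim r(1) by simp
      then have "r + t * (r - 1) > 0"
        using elim unfolding right_diff_distrib by linarith
      then have "f1 ((r + t * (r - 1)) *\<^sub>R u) = (r + t * (r - 1)) * f1 u"
        by (rule pos_homogeneous_on_one(2)[OF hom uD])
      also have "\<dots> = (1 + t) * f2 a - t * f1 u"
        using r(2) by (simp add: algebra_simps flip: r(2))
      also have "(r + t * (r - 1)) *\<^sub>R u = r *\<^sub>R u + t *\<^sub>R (r *\<^sub>R u - u)"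
        by (simp add: algebra_simps)
      finally show ?case
        unfolding linearization_affine lin by (simp add: algebra_simps)
    qed
  qed (use a lin in auto)
next
  assume hom: "pos_homogeneous_on D2 f2 1"
  define r where "r = f1 u / f2 a"
  have r: "r > 0" "r * f2 a = f1 u"
    using sign by (auto simp: r_def zero_less_mult_iff zero_less_divide_iff)
  have aD: "a \<in> D2"
    using a interior_subset by blast
  have "gradient f2 a \<bullet> a = f2 a"
    using linearization_pos_homogeneous[OF hom aD a(2), of a] by (simp add: linearization_def)
  then have lin: "linearization f2 a (r *\<^sub>R a) = r * f2 a"
    using linearization_pos_homogeneous[OF hom aD a(2)] by simp
  show thesis
  proof (rule that[of u "r *\<^sub>R a"])
    show "r *\<^sub>R a \<in> interior D2"
      using pos_homogeneous_on_interior[OF hom a(1) r(1)] .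
    have *: "f2 (r *\<^sub>R a) = r * f2 a"
      using pos_homogeneous_on_one(2)[OF hom aD r(1)] .
    show "f1 u = f2 (r *\<^sub>R a)" "f2 (r *\<^sub>R a) = linearization f2 a (r *\<^sub>R a)"
      using * lin r(2) by simp_all
    show "\<forall>\<^sub>F t in at_right 0. f1 (u + t *\<^sub>R (u - u))
        - linearization f2 a (r *\<^sub>R a + t *\<^sub>R (r *\<^sub>R a - v)) = t * (linearization f2 a v - f1 u)"
      unfolding linearization_affine lin r(2) by (simp add: algebra_simps)
  qed (use u in auto)
qed

text \<open>Supplies a point of \<open>D1 \<times> D2\<close> outside \<open>S\<close>: as the two
  values have the same sign, scaling one of them reverses the order if necessary.\<close>

lemma exists_less_of_pos_homogeneous:
  fixes f1 :: "'a::euclidean_space \<Rightarrow> real" and f2 :: "'b::euclidean_space \<Rightarrow> real"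
  assumes homogeneous: "pos_homogeneous_on D1 f1 1 \<or> pos_homogeneous_on D2 f2 1"
    and uv: "u \<in> D1" "v \<in> D2" and sign: "f1 u * f2 v > 0"
  obtains u' v' where "u' \<in> D1" "v' \<in> D2" "f2 v' < f1 u'"
proof -
  \<comment> \<open>The witness makes \<open>r * x\<close> equal to \<open>2 * y\<close> when
    \<open>y > 0\<close> and to \<open>y / 2\<close> when \<open>y < 0\<close>; both exceed
    \<open>y\<close>.\<close>
  have scale: "\<exists>r>0. y < r * x" if "x * y > 0" for x y :: real
  proof (cases "x > 0")
    case True
    then show ?thesis
      using that by (intro exI[of _ "2 * y / x"]) (auto simp: zero_less_mult_iff field_simps)
  next
    case False
    then show ?thesis
      using that by (intro exI[of _ "y / x / 2"]) (auto simp: zero_less_mult_iff field_simps)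
  qed
  show thesis
    using homogeneous
  proof
    assume "pos_homogeneous_on D1 f1 1"
    then show thesis
      using scale[OF sign] pos_homogeneous_on_one[of D1 f1 u] uv that by metis
  next
    assume "pos_homogeneous_on D2 f2 1"
    \<comment> \<open>Negating both values turns the required upper bound on \<open>r * f2 v\<close>
      into the lower bound given by \<open>scale\<close>.\<close>
    moreover obtain r where "r > 0" "- f1 u < r * - f2 v"
      using scale[of "- f2 v" "- f1 u"] sign by (auto simp: mult.commute)
    ultimately show thesis
      using pos_homogeneous_on_one[of D2 f2 v r] uv that[of u "r *\<^sub>R v"] by simp
  qed
qed

section \<open>Freeness and maximality\<close>

lemma interior_superlevel_linearization:
  fixes f1 :: "'a::euclidean_space \<Rightarrow> real" and f2 :: "'b::euclidean_space \<Rightarrow> real"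
  assumes homogeneous: "pos_homogeneous_on D1 f1 1 \<or> pos_homogeneous_on D2 f2 1"
    and a: "a \<in> interior D2" "f2 differentiable (at a)"
    and nonzero: "\<forall>u\<in>interior D1. f1 u \<noteq> 0"
    and uv: "(u, v) \<in> interior {(u, v). u \<in> D1 \<and> v \<in> D2 \<and> f1 u - linearization f2 a v \<ge> 0}"
      (is "_ \<in> interior ?C")
  shows "f1 u \<noteq> linearization f2 a v"
proof
  assume eq: "f1 u = linearization f2 a v"
  have "interior ?C \<subseteq> interior (D1 \<times> D2)"
    by (rule interior_mono) auto
  then have int: "u \<in> interior D1" "v \<in> interior D2"
    using uv by (auto simp: interior_Times)
  then have D: "u \<in> D1" "v \<in> D2"
    using interior_subset by blast+
  have D': "a \<in> D2"
    using a interior_subset by blast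
  \<comment> \<open>The direction is \<open>(u, 0)\<close> if \<open>f1\<close> is homogeneous and
    \<open>(0, - v)\<close> if \<open>f2\<close> is, since then the linearization is linear. Either
    way the difference is \<open>t * f1 u\<close>, which changes sign at \<open>t = 0\<close> unless
    \<open>f1 u = 0\<close>.\<close>
  obtain d e where de: "\<And>t. \<bar>t\<bar> < 1 \<Longrightarrow>
      f1 (u + t *\<^sub>R d) - linearization f2 a (v + t *\<^sub>R e) = t * f1 u"
    using homogeneous
  proof
    assume hom: "pos_homogeneous_on D1 f1 1"
    show thesis
    proof (rule that[of u 0])
      fix t :: real assume "\<bar>t\<bar> < 1"
      then show "f1 (u + t *\<^sub>R u) - linearization f2 a (v + t *\<^sub>R 0) = t * f1 u"
        using pos_homogeneous_on_one(2)[OF hom D(1), of "1 + t"] eq by (simp add: algebra_simps)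
    qed
  next
    assume hom: "pos_homogeneous_on D2 f2 1"
    show thesis
      by (rule that[of 0 "- v"])
        (use eq linearization_pos_homogeneous[OF hom D' a(2)] in
          \<open>simp add: inner_diff_right algebra_simps\<close>)
  qed
  have "\<forall>\<^sub>F t in at 0. (u, v) + t *\<^sub>R (d, e) \<in> interior ?C"
    by (rule eventually_ray_in_interior[OF uv])
  moreover have "\<forall>\<^sub>F t in at 0. \<bar>t\<bar> < (1::real)"
    by (auto simp: eventually_at dist_real_def intro!: exI[of _ 1])
  ultimately have "\<forall>\<^sub>F t in at 0. 0 \<le> t * f1 u"
  proof eventually_elim
    case (elim t)
    then show ?case
      using de[of t] interior_subset[of ?C] by auto
  qed
  then obtain \<delta> where \<delta>: "\<delta> > 0" "\<And>t. t \<noteq> 0 \<Longrightarrow> \<bar>t\<bar> < \<delta> \<Longrightarrow> 0 \<le> t * f1 u"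
    by (auto simp: eventually_at dist_real_def)
  have "f1 u = 0"
    using \<delta>(2)[of "\<delta> / 2"] \<delta>(2)[of "- \<delta> / 2"] \<delta>(1)
    by (auto simp: zero_le_mult_iff mult_le_0_iff zero_le_divide_iff divide_le_0_iff)
  then show False
    using nonzero int by blast
qed

text \<open>Here \<open>K\<close> is a convex set enlarging \<open>C\<close> within
  \<open>D1 \<times> D2\<close>. The conclusion contradicts freeness of \<open>K\<close>, because
  \<open>f1 p = f2 q\<close> puts \<open>(p, q)\<close> in \<open>S\<close>.\<close>

lemma superlevel_linearization_maximal:
  fixes f1 :: "'a::euclidean_space \<Rightarrow> real" and f2 :: "'b::euclidean_space \<Rightarrow> real"
    and a :: 'b and D1 D2
  defines "C \<equiv> {(u, v). u \<in> D1 \<and> v \<in> D2 \<and> f1 u - linearization f2 a v \<ge> 0}"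
  assumes D1: "convex D1" "interior D1 \<noteq> {}" and D2: "convex D2"
    and cont: "continuous_on (interior D1) f1" and closed: "closed C"
    and homogeneous: "pos_homogeneous_on D1 f1 1 \<or> pos_homogeneous_on D2 f2 1"
    and a: "a \<in> interior D2" "f2 differentiable (at a)"
    and sign: "\<forall>u\<in>interior D1. f1 u * f2 a > 0"
    and K: "convex K" "C \<subseteq> K" "w \<in> K" "w \<in> D1 \<times> D2" "w \<notin> C"
  obtains p q where "(p, q) \<in> interior K" "p \<in> D1" "q \<in> D2" "f1 p = f2 q"
proof -
  let ?h = "\<lambda>x. f1 (fst x) - linearization f2 a (snd x)"
  obtain u1 where u1: "u1 \<in> interior D1"
    using D1(2) by blast
  \<comment> \<open>This first contact point lies in \<open>C\<close> and in the interior of the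
    product; \<open>w\<close> is moved towards it.\<close>
  obtain p0 q0 where p0: "p0 \<in> interior D1" "q0 \<in> interior D2"
    "f1 p0 = f2 q0" "f2 q0 = linearization f2 a q0"
    using contact_point[OF homogeneous a u1 bspec[OF sign u1]] by blast
  have D: "x \<in> interior D1 \<Longrightarrow> x \<in> D1" "y \<in> interior D2 \<Longrightarrow> y \<in> D2" for x y
    using interior_subset by blast+
  have p0C: "(p0, q0) \<in> C"
    using p0 D by (simp add: C_def)
  have "((\<lambda>t. w - t *\<^sub>R (w - (p0, q0))) \<longlongrightarrow> w - 0 *\<^sub>R (w - (p0, q0))) (at_right (0::real))"
    by (intro tendsto_intros)
  then have "\<forall>\<^sub>F t in at_right (0::real). w - t *\<^sub>R (w - (p0, q0)) \<in> - C"
    using closed K(5) by (intro topological_tendstoD) (auto simp: open_Compl)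
  then have "\<forall>\<^sub>F t in at_right (0::real). 0 < t \<and> t < 1 \<and> w - t *\<^sub>R (w - (p0, q0)) \<in> - C"
    by (intro eventually_conj) (auto simp: eventually_at_right_field intro: exI[of _ 1])
  then obtain t where t: "0 < t" "t < 1" "w - t *\<^sub>R (w - (p0, q0)) \<notin> C"
    using eventually_happens[of _ "at_right (0::real)"] by auto
  define u v where "u = fst w - t *\<^sub>R (fst w - p0)" and "v = snd w - t *\<^sub>R (snd w - q0)"
  have uv: "(u, v) = w - t *\<^sub>R (w - (p0, q0))"
    by (simp add: u_def v_def prod_eq_iff)
  have u: "u \<in> interior D1"
    unfolding u_def using D1(1) p0(1) K(4) t by (intro mem_interior_convex_shrink) auto
  have v: "v \<in> interior D2"
    unfolding v_def using D2 p0(2) K(4) t by (intro mem_interior_convex_shrink) auto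
  have neg: "f1 u < linearization f2 a v"
    using t(3) u v D unfolding uv[symmetric] C_def by auto
  have "(u, v) = (1 - t) *\<^sub>R w + t *\<^sub>R (p0, q0)"
    unfolding uv by (simp add: algebra_simps)
  then have uvK: "(u, v) \<in> K"
    using convexD[OF K(1,3), of "(p0, q0)" "1 - t" t] K(2) p0C t by auto
  \<comment> \<open>The second contact point is built from \<open>(u, v)\<close>, so the slope along
    the ray beyond it is \<open>linearization f2 a v - f1 u\<close>, positive by
    \<open>neg\<close>.\<close>
  obtain p q where pq: "p \<in> interior D1" "q \<in> interior D2" "f1 p = f2 q"
    and ev: "\<forall>\<^sub>F t in at_right 0. f1 (p + t *\<^sub>R (p - u)) - linearization f2 a (q + t *\<^sub>R (q - v))
            = t * (linearization f2 a v - f1 u)"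
    using contact_point[OF homogeneous a u bspec[OF sign u], where v = v] by blast
  have pqG: "(p, q) \<in> interior (D1 \<times> D2)"
    using pq by (simp add: interior_Times)
  have "\<forall>\<^sub>F t in at_right 0. (p, q) + t *\<^sub>R ((p, q) - (u, v)) \<in> interior (D1 \<times> D2)"
    using eventually_ray_in_interior[OF pqG, of "(p, q) - (u, v)"]
    unfolding eventually_at_split by (rule conjunct2)
  with ev have "\<forall>\<^sub>F t in at_right 0. 0 < t \<and> (p, q) + t *\<^sub>R ((p, q) - (u, v)) \<in> interior (D1 \<times> D2) \<and>
      ?h ((p, q) + t *\<^sub>R ((p, q) - (u, v))) > 0"
    using eventually_at_right_less[of "0::real"]
    by eventually_elim (use neg in auto)
  then obtain s where s: "0 < s" "(p, q) + s *\<^sub>R ((p, q) - (u, v)) \<in> interior (D1 \<times> D2)"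
      "?h ((p, q) + s *\<^sub>R ((p, q) - (u, v))) > 0"
    using eventually_happens[of _ "at_right (0::real)"] by auto
  define z where "z = (p, q) + s *\<^sub>R ((p, q) - (u, v))"
  \<comment> \<open>Continuity of \<open>f1\<close> on the interior makes the strict superlevel set
    open there, so \<open>z\<close> is interior to \<open>K\<close> and not merely in
    \<open>C\<close>.\<close>
  have "continuous_on (interior (D1 \<times> D2)) ?h"
    by (intro continuous_intros continuous_on_compose2[OF cont]) (auto simp: interior_Times)
  then have "open (interior (D1 \<times> D2) \<inter> ?h -` {0<..})"
    by (intro continuous_open_preimage) auto
  moreover have "interior (D1 \<times> D2) \<inter> ?h -` {0<..} \<subseteq> K"
    using K(2) D by (force simp: C_def interior_Times)
  ultimately have "interior (D1 \<times> D2) \<inter> ?h -` {0<..} \<subseteq> interior K"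
    by (intro interior_maximal)
  moreover have "z \<in> interior (D1 \<times> D2) \<inter> ?h -` {0<..}"
    using s(2,3) by (simp only: z_def vimage_eq Int_iff greaterThan_iff)
  ultimately have "z \<in> interior K"
    by blast
  \<comment> \<open>The weight \<open>1 / (1 + s)\<close> on \<open>z\<close> inverts the
    extrapolation by \<open>s\<close>, so this point is \<open>(p, q)\<close>.\<close>
  then have "(u, v) - (1 / (1 + s)) *\<^sub>R ((u, v) - z) \<in> interior K"
    using K(1) uvK s(1) by (intro mem_interior_convex_shrink) auto
  moreover have "(u, v) - z = (1 + s) *\<^sub>R ((u, v) - (p, q))"
    by (simp add: z_def prod_eq_iff algebra_simps)
  ultimately have "(p, q) \<in> interior K"
    using s(1) by simp
  then show thesis
    using that pq D by blast
qed

theorem theorem2: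
  fixes f1 :: "real ^ 'm \<Rightarrow> real" and D1 :: "(real ^ 'm) set"
    and f2 :: "real ^ 'n \<Rightarrow> real" and D2 :: "(real ^ 'n) set"
    and S C :: "((real ^ 'm) \<times> (real ^ 'n)) set"
    and vt :: "real ^ 'n"
  assumes dom1: "closed D1" "convex D1"
    and dom2: "closed D2" "convex D2"
    and concave: "concave_on D1 f1" "concave_on D2 f2"
    and closed_f1: "closed_hypograph_on D1 f1"
    and S_def: "S = {(u, v). u \<in> D1 \<and> v \<in> D2 \<and> f1 u - f2 v \<le> 0}"
    and homogeneous: "pos_homogeneous_on D1 f1 1 \<or> pos_homogeneous_on D2 f2 1"
    and sign: "((\<forall>u\<in>interior D1. f1 u > 0) \<and> (\<forall>v\<in>interior D2. f2 v > 0)) \<or>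
               ((\<forall>u\<in>interior D1. f1 u < 0) \<and> (\<forall>v\<in>interior D2. f2 v < 0))"
    and smooth: "continuously_differentiable_on_open (interior D1) f1"
    and full_dim: "aff_dim D1 = int CARD('m)" "aff_dim D2 = int CARD('n)"
    and vt: "vt \<in> interior D2" "f2 differentiable (at vt)"
    and C_def: "C = {(u, v). u \<in> D1 \<and> v \<in> D2 \<and> f1 u - linearization f2 vt v \<ge> 0}"
  shows "maximal_S_free_in S (D1 \<times> D2) C"
proof -
  let ?lin = "linearization f2 vt"
  have int_D1: "interior D1 \<noteq> {}"
    using interior_nonempty_full_aff_dim[OF dom1(2)] full_dim(1) by simp
  then obtain u0 where u0: "u0 \<in> interior D1"
    by blast
  have D: "u0 \<in> D1" "vt \<in> D2"
    using u0 vt interior_subset by blast+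
  have sgn: "\<forall>u\<in>interior D1. f1 u * f2 vt > 0"
    using sign vt(1) by (auto simp: mult_neg_neg)
  have cont: "continuous_on (interior D1) f1"
    using smooth unfolding continuously_differentiable_on_open_def
    by (auto intro!: continuous_at_imp_continuous_on differentiable_imp_continuous_within)
  have closed_C: "closed C"
    unfolding C_def by (rule superlevel_linearization_closed[OF closed_f1 dom2(1)])
  have convex_C: "convex C"
    unfolding C_def by (rule superlevel_linearization_convex[OF concave(1) dom2(2)])
  have S_proper: "S \<subset> D1 \<times> D2"
  proof -
    obtain u v where "u \<in> D1" "v \<in> D2" "f2 v < f1 u"
      using exists_less_of_pos_homogeneous[OF homogeneous D] sgn u0 by metis
    then have "(u, v) \<in> D1 \<times> D2 - S"
      by (simp add: S_def)
    then show ?thesis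
      unfolding S_def by blast
  qed
  have "interior C \<inter> S = {}"
  proof (rule ccontr)
    assume "interior C \<inter> S \<noteq> {}"
    then obtain u v where uv: "(u, v) \<in> interior C" "(u, v) \<in> S"
      by auto
    then have "(u, v) \<in> C"
      using interior_subset by blast
    \<comment> \<open>Closes the chain \<open>f1 u \<le> f2 v \<le> ?lin v \<le> f1 u\<close>, whose
      outer bounds come from \<open>S\<close> and \<open>C\<close>.\<close>
    moreover have "f2 v \<le> ?lin v"
      using concave_on_le_linearization[OF concave(2) D(2) _ vt(2)] uv(2) by (simp add: S_def)
    ultimately have "f1 u = ?lin v"
      using uv(2) by (simp add: S_def C_def)
    moreover have "\<forall>u\<in>interior D1. f1 u \<noteq> 0"
      using sgn by auto
    ultimately show False
      using interior_superlevel_linearization[OF homogeneous vt, folded C_def] uv(1) by blast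
  qed
  then have free: "S_free S C"
    using S_proper closed_C convex_C by (auto simp: S_free_def)
  have "\<not> (\<exists>K. S_free S K \<and> C \<inter> (D1 \<times> D2) \<subset> K \<inter> (D1 \<times> D2))"
  proof
    assume "\<exists>K. S_free S K \<and> C \<inter> (D1 \<times> D2) \<subset> K \<inter> (D1 \<times> D2)"
    then obtain K where K: "S_free S K" "C \<inter> (D1 \<times> D2) \<subset> K \<inter> (D1 \<times> D2)"
      by blast
    have "C \<subseteq> D1 \<times> D2"
      by (auto simp: C_def)
    then have "C \<subseteq> K"
      using K(2) by blast
    moreover obtain w where "w \<in> K" "w \<in> D1 \<times> D2" "w \<notin> C"
      using K(2) by blast
    moreover have "convex K"
      using K(1) by (simp add: S_free_def)
    ultimately obtain p q where "(p, q) \<in> interior K" "p \<in> D1" "q \<in> D2" "f1 p = f2 q"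
      using superlevel_linearization_maximal[OF dom1(2) int_D1 dom2(2) cont
          closed_C[unfolded C_def] homogeneous vt sgn, folded C_def] by metis
    then show False
      using K(1) by (auto simp: S_free_def S_def)
  qed
  then show ?thesis
    unfolding maximal_S_free_in_def
    using dom1 dom2 S_proper free by (auto intro!: closed_Times convex_Times)
qed

end
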